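(* Let $x,\nu$ be (real or complex) parameters and let $F(t)=F(t:x,\nu)=e^{xt-\frac{\nu t^{2}}{2}}$. Let the coefficients $a_i(N,\nu)$ ($N\in\mathbb{N}\cup\{0\}$, $0\le i\le N$) be determined by $$a_{N}(N,\nu)=a_{N-1}(N-1,\nu)=\cdots=a_{1}(1,\nu)=a_{0}(0,\nu)=1\quad(N\ge 0),$$ $$a_{N-1}(N,\nu)=a_{N-2}(N-1,\nu)=\cdots=a_{1}(2,\nu)=a_{0}(1,\nu)=0\quad(N\ge 1),$$ $$a_{0}(N,\nu)=-\nu\,a_{1}(N-1,\nu)\quad(N\ge 2),$$ $$a_{i}(N,\nu)=-(i+1)\,\nu\,a_{i+1}(N-1,\nu)+a_{i-1}(N-1,\nu)\quad(1\le i\le N-2).$$ Then for every $N\in\mathbb{N}\cup\{0\}$, $F$ is a solution of the linear differential equation $$F^{(N)}=\left(\frac{d}{dt}\right)^{N}F(t:x,\nu)=\left(\sum_{i=0}^{N}a_{i}(N,\nu)\,(x-\nu t)^{i}\right)F.$$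
   Context: $F^{(N)}$ denotes the $N$-th derivative of $F$ with respect to $t$, with $F^{(0)}=F$. *)

theory Defs
  imports "HOL-Analysis.Analysis"
begin

text \<open>
  The sort \<open>{real_normed_field, banach}\<close> is the one on which the library defines \<open>exp\<close>.
  It contains \<open>real\<close> and \<open>complex\<close>, so the parameters are real (and \<open>t\<close> is real)
  or complex (and \<open>t\<close> is complex).
\<close>

definition F :: "'a::{real_normed_field,banach} \<Rightarrow> 'a \<Rightarrow> 'a \<Rightarrow> 'a"
  where "F x \<nu> t = exp (x * t - \<nu> * t\<^sup>2 / 2)"

end

theory Submission
  imports Defs
begin

text \<open>
  Put \<open>y = x - \<nu> t\<close>. Then \<open>F' = y F\<close> and \<open>y' = -\<nu>\<close>, so for a polynomial \<open>p\<close> the derivative of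
  \<open>p(y) F\<close> is \<open>q(y) F\<close> with \<open>q = X p - \<nu> p'\<close> (lemma \<open>poly_times_F_has_derivative\<close>). Starting
  from the constant \<open>1\<close>, the \<open>N\<close>-th derivative of \<open>F\<close> is therefore \<open>P\<^sub>N(y) F\<close>, where
  \<open>P\<^sub>N\<^sub>+\<^sub>1 = X P\<^sub>N - \<nu> P\<^sub>N'\<close>; these are Hermite polynomials scaled by \<open>\<nu>\<close>.

  The four conditions on \<open>a\<close> are this recursion read off coefficient by coefficient: once
  the numbers \<open>a\<^sub>i(N)\<close> are continued by zero to \<open>i > N\<close> and to \<open>i = -1\<close>, the special rules for
  \<open>i = N\<close>, \<open>i = N - 1\<close> and \<open>i = 0\<close> agree with the general one
  (lemma \<open>coefficient_poly_Suc\<close>).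
\<close>

lemma F_has_field_derivative:
  "(F x \<nu> has_field_derivative (x - \<nu> * t) * F x \<nu> t) (at t)"
  unfolding F_def by (rule derivative_eq_intros refl | simp)+

text \<open>Of the two terms, \<open>X p\<close> comes from \<open>F' = (x - \<nu> t) F\<close> and \<open>-\<nu> p'\<close> from the chain rule,
  so differentiation stays inside the multiples of \<open>F\<close> by polynomials in \<open>x - \<nu> t\<close>.\<close>

lemma poly_times_F_has_derivative:
  "((\<lambda>t. poly p (x - \<nu> * t) * F x \<nu> t) has_field_derivative
      poly (pCons 0 p - smult \<nu> (pderiv p)) (x - \<nu> * t) * F x \<nu> t) (at t)"
proof -
  have "((\<lambda>t. x - \<nu> * t) has_field_derivative - \<nu>) (at t)"
    by (rule derivative_eq_intros refl | simp)+
  from DERIV_chain2[OF poly_DERIV this]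
  have "((\<lambda>t. poly p (x - \<nu> * t)) has_field_derivative
           poly (pderiv p) (x - \<nu> * t) * - \<nu>) (at t)" .
  from DERIV_mult[OF this F_has_field_derivative] show ?thesis
    by (rule DERIV_cong) (simp add: algebra_simps)
qed

definition coefficient_poly :: "(nat \<Rightarrow> nat \<Rightarrow> 'a \<Rightarrow> 'a) \<Rightarrow> 'a \<Rightarrow> nat \<Rightarrow> 'a::comm_ring_1 poly"
  where "coefficient_poly a \<nu> N = (\<Sum>i=0..N. monom (a i N \<nu>) i)"

lemma poly_coefficient_poly:
  "poly (coefficient_poly a \<nu> N) y = (\<Sum>i=0..N. a i N \<nu> * y ^ i)"
  by (simp add: coefficient_poly_def poly_sum poly_monom)

lemma coeff_coefficient_poly:
  "coeff (coefficient_poly a \<nu> N) i = (if i \<le> N then a i N \<nu> else 0)"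
  by (simp add: coefficient_poly_def coeff_sum)

text \<open>Comparison of coefficients of \<open>X\<^sup>i\<close>. The prescribed values are needed exactly where the
  rule for the interior would refer to a coefficient above the diagonal or to index \<open>-1\<close>:
  for \<open>i = N + 1\<close> it reduces to \<open>1 = 1\<close>, for \<open>i = N\<close> to \<open>0 = 0\<close>, and for \<open>i = 0\<close> the term
  from \<open>X P\<^sub>N\<close> is absent.\<close>

lemma coefficient_poly_Suc:
  fixes \<nu> :: "'a::idom"
  assumes diag: "\<And>N. a N N \<nu> = 1"
    and subdiag: "\<And>N. a N (Suc N) \<nu> = 0"
    and zero: "\<And>N. N \<ge> 2 \<Longrightarrow> a 0 N \<nu> = - \<nu> * a 1 (N - 1) \<nu>"
    and interior: "\<And>N i. 1 \<le> i \<Longrightarrow> i + 2 \<le> N \<Longrightarrow>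
           a i N \<nu> = - of_nat (i + 1) * \<nu> * a (i + 1) (N - 1) \<nu> + a (i - 1) (N - 1) \<nu>"
  shows "coefficient_poly a \<nu> (Suc N) =
           pCons 0 (coefficient_poly a \<nu> N) - smult \<nu> (pderiv (coefficient_poly a \<nu> N))"
proof (rule poly_eqI)
  fix i
  consider "i > Suc N" | "i = Suc N" | "i = N" | "i = 0" "i < N" | "0 < i" "i < N"
    by linarith
  then show "coeff (coefficient_poly a \<nu> (Suc N)) i =
      coeff (pCons 0 (coefficient_poly a \<nu> N) - smult \<nu> (pderiv (coefficient_poly a \<nu> N))) i"
  proof cases
    case 3
    then show ?thesis using subdiag
      by (cases N) (simp_all add: coeff_coefficient_poly coeff_pderiv)
  next
    case 4
    then show ?thesis using zero[of "Suc N"]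
      by (simp add: coeff_coefficient_poly coeff_pderiv)
  next
    case 5
    then obtain j where "i = Suc j" using gr0_implies_Suc by blast
    then show ?thesis using 5 interior[of i "Suc N"]
      by (simp add: coeff_coefficient_poly coeff_pderiv algebra_simps)
  qed (auto simp: coeff_coefficient_poly coeff_pderiv coeff_pCons diag split: nat.split)
qed

theorem theorem1:
  fixes x \<nu> :: "'a::{real_normed_field,banach}"
    and a :: "nat \<Rightarrow> nat \<Rightarrow> 'a \<Rightarrow> 'a"
  assumes "\<forall>N. a N N \<nu> = 1"
    and "\<forall>N\<ge>1. a (N - 1) N \<nu> = 0"
    and "\<forall>N\<ge>2. a 0 N \<nu> = - \<nu> * a 1 (N - 1) \<nu>"
    and "\<forall>N i. 1 \<le> i \<and> i + 2 \<le> N \<longrightarrow>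
           a i N \<nu> = - of_nat (i + 1) * \<nu> * a (i + 1) (N - 1) \<nu> + a (i - 1) (N - 1) \<nu>"
  shows "\<forall>N t. (\<forall>k<N. (deriv ^^ k) (F x \<nu>) field_differentiable at t) \<and>
           (deriv ^^ N) (F x \<nu>) t = (\<Sum>i=0..N. a i N \<nu> * (x - \<nu> * t) ^ i) * F x \<nu> t"
proof -
  let ?P = "coefficient_poly a \<nu>"
  have subdiag: "a N (Suc N) \<nu> = 0" for N
    using assms(2)[rule_format, of "Suc N"] by simp
  have step: "?P (Suc N) = pCons 0 (?P N) - smult \<nu> (pderiv (?P N))" for N
    using assms(1,3,4) subdiag by (intro coefficient_poly_Suc) blast+
  have deriv_step: "((\<lambda>t. poly (?P N) (x - \<nu> * t) * F x \<nu> t) has_field_derivative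
      poly (?P (Suc N)) (x - \<nu> * t) * F x \<nu> t) (at t)" for N t
    unfolding step by (rule poly_times_F_has_derivative)
  have iterate: "(deriv ^^ N) (F x \<nu>) = (\<lambda>t. poly (?P N) (x - \<nu> * t) * F x \<nu> t)" for N
  proof (induction N)
    case 0
    then show ?case using assms(1) by (simp add: poly_coefficient_poly)
  next
    case (Suc N)
    then show ?case using DERIV_imp_deriv[OF deriv_step] by auto
  qed
  have "(deriv ^^ N) (F x \<nu>) field_differentiable at t" for N t
    unfolding iterate field_differentiable_def using deriv_step by blast
  then show ?thesis
    by (simp add: iterate poly_coefficient_poly)
qed

end
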